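(* Let $n\ge 2$, $1\le d\le n-1$, $q=n-d$, $A\in\mathbf{Gr}(d,n)$ and $k\in\mathbb{Z}^n$. Suppose that $f\in\mathcal{T}'$ and $f=(1-\Delta)^sh$ with $h\in C(\mathbb{T}^n)$ and $s\ge 0$. If $k\perp A$, then $$\hat f(k)=\langle k\rangle^{2s}\,\widehat{R_{d,A}h}(k)=\widehat{R_{d,A}f}(k),$$ where $\widehat{R_{d,A}h}(k)$ can be calculated by the formula $$\widehat{R_{d,A}h}(k)=\int_{[0,1]^q}R_{d,A}h(\phi_A(T,0))\,\exp\bigl(-2\pi i(k_{1_A}t_{1_A}+\cdots+k_{q_A}t_{q_A})\bigr)\,dT.$$
   Context: Let $\mathbb{T}^n=\mathbb{R}^n/\mathbb{Z}^n$, $\mathcal{T}=C^\infty(\mathbb{T}^n)$, and let $\mathcal{T}'$ be its dual, the space of periodic distributions, with duality pairing $(\cdot,\cdot)$ (so $(f,g)=\int_{\mathbb{T}^n}fg$ for functions). Fourier coefficients are $\hat f(k)=(f,e^{-2\pi i k\cdot x})$, $k\in\mathbb{Z}^n$. Write $\langle k\rangle=(1+|k|^2)^{1/2}$; $(1-\Delta)^{s}$ denotes the Fourier multiplier with symbol $\langle k\rangle^{2s}$. $\mathbf{Gr}(d,n)$ is the set of all $d$-dimensional linear subspaces of $\mathbb{Q}^n$; $k\perp A$ means $k\cdot v=0$ for all $v\in A$. Radon transform: for a continuous function $f$ on $\mathbb{T}^n$ and linearly independent $v_1,\dots,v_d\in\mathbb{Z}^n$, with $A=\{v_1,\dots,v_d\}$,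 $R_df(x,A)=\int_{[0,1]^d}f(x+t_1v_1+\cdots+t_dv_d)\,dt_1\cdots dt_d$. For $f\in\mathcal{T}'$, $R_df(\cdot,A)\in\mathcal{T}'$ is defined by $(R_df(\cdot,A),g)=(f,R_dg(\cdot,A))$ for all $g\in\mathcal{T}$. This depends only on the subspace of $\mathbb{Q}^n$ spanned by $A$, so $R_df(\cdot,A)$ is regarded as defined for $A\in\mathbf{Gr}(d,n)$; write $R_{d,A}f=R_df(\cdot,A)$. Coordinates $\phi_A$: represent $A\in\mathbf{Gr}(d,n)$ by linearly independent integer vectors $v_1,\dots,v_d\in\mathbb{Z}^n$ spanning it, and let $V\subset\mathbb{R}^n$ be their real span. Fix distinct standard unit vectors $e_{1_A},\dots,e_{q_A}\in\{e_1,\dots,e_n\}$ with $e_{i_A}\notin V$ such that $\{v_1,\dots,v_d,e_{1_A},\dots,e_{q_A}\}$ spans $\mathbb{R}^n$. Define $\phi_A(T,S)=t_{1_A}e_{1_A}+\cdots+t_{q_A}e_{q_A}+s_1v_1+\cdots+s_dv_d$ for $T=(t_{1_A},\dots,t_{q_A})\in[0,1]^q$, $S=(s_1,\dots,s_d)\in[0,1]^d$ (points of $\mathbb{R}^n$ are projected to $\mathbb{T}^n$), and let $k_{i_A}=k\cdot e_{i_A}$. *)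

theory Defs
  imports "HOL-Analysis.Analysis"
begin

text \<open>
  Functions on the torus are represented by \<open>\<int>\<^sup>n\<close>-periodic functions on \<^typ>\<open>real^'n\<close>,
  where \<open>n = CARD('n)\<close>.  Functionals on test functions are extensional, so that equality of
  distributions is equality in HOL.
\<close>

definition of_int_vec :: "int^'n \<Rightarrow> 'a::ring_1^'n" where
  "of_int_vec k = (\<chi> i. of_int (k $ i))"

definition periodic :: "(real^'n \<Rightarrow> complex) \<Rightarrow> bool" where
  "periodic f \<longleftrightarrow> (\<forall>x m. f (x + of_int_vec m) = f x)"

definition torus_continuous :: "(real^'n \<Rightarrow> complex) set" where
  "torus_continuous = {f. continuous_on UNIV f \<and> periodic f}"

definition torus_integral :: "(real^'n \<Rightarrow> complex) \<Rightarrow> complex" where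
  "torus_integral f = (LINT x:cbox 0 1|lborel. f x)"

subsection \<open>Test functions and periodic distributions\<close>

definition partial_deriv :: "'n \<Rightarrow> (real^'n \<Rightarrow> complex) \<Rightarrow> real^'n \<Rightarrow> complex" where
  "partial_deriv i f x = frechet_derivative f (at x) (axis i 1)"

definition iter_deriv :: "'n list \<Rightarrow> (real^'n \<Rightarrow> complex) \<Rightarrow> real^'n \<Rightarrow> complex" where
  "iter_deriv is f = foldr partial_deriv is f"

definition smooth :: "(real^'n \<Rightarrow> complex) \<Rightarrow> bool" where
  "smooth f \<longleftrightarrow> (\<forall>is x. iter_deriv is f differentiable (at x))"

definition test_fun :: "(real^'n \<Rightarrow> complex) set" where
  "test_fun = {g. periodic g \<and> smooth g}"

definition test_seminorm :: "'n list \<Rightarrow> (real^'n \<Rightarrow> complex) \<Rightarrow> real" where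
  "test_seminorm is g = (SUP x. norm (iter_deriv is g x))"

text \<open>The usual Frechet topology: uniform convergence of every derivative.\<close>

definition test_topology :: "(real^'n \<Rightarrow> complex) topology" where
  "test_topology = topology_generated_by
     {{g \<in> test_fun. test_seminorm is (\<lambda>x. g x - g0 x) < r} | is g0 r. g0 \<in> test_fun \<and> r > 0}"

type_synonym 'n functional = "(real^'n \<Rightarrow> complex) \<Rightarrow> complex"

definition periodic_distributions :: "'n::finite functional set" where
  "periodic_distributions = {u \<in> extensional test_fun.
     (\<forall>g\<in>test_fun. \<forall>h\<in>test_fun. \<forall>a b. u (\<lambda>x. a * g x + b * h x) = a * u g + b * u h) \<and>
     continuous_map test_topology euclidean u}"

definition distr_of :: "(real^'n \<Rightarrow> complex) \<Rightarrow> 'n::finite functional" where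
  "distr_of f = (\<lambda>g\<in>test_fun. torus_integral (\<lambda>x. f x * g x))"

subsection \<open>Fourier coefficients and multipliers\<close>

definition character :: "int^'n \<Rightarrow> real^'n \<Rightarrow> complex" where
  "character k x = exp (2 * of_real pi * \<i> * of_real (of_int_vec k \<bullet> x))"

definition fourier_coeff :: "'n::finite functional \<Rightarrow> int^'n \<Rightarrow> complex" where
  "fourier_coeff u k = u (character (-k))"

definition japanese_bracket :: "int^'n \<Rightarrow> real" where
  "japanese_bracket k = sqrt (1 + (norm (of_int_vec k :: real^'n))\<^sup>2)"

text \<open>
  The multiplier with symbol \<open>m\<close> maps \<open>u\<close> to the distribution with Fourier series
  \<open>\<Sum>k. m k * fourier_coeff u k * character k\<close>, the series being evaluated weakly, that is, after
  pairing with a test function.  For \<open>m\<close> of polynomial growth it converges absolutely.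
\<close>

definition fourier_multiplier ::
    "(int^'n \<Rightarrow> complex) \<Rightarrow> 'n::finite functional \<Rightarrow> 'n functional" where
  "fourier_multiplier m u =
     (\<lambda>g\<in>test_fun. \<Sum>\<^sub>\<infinity>k. m k * fourier_coeff u k * distr_of (character k) g)"

definition one_minus_laplacian_pow :: "real \<Rightarrow> 'n::finite functional \<Rightarrow> 'n functional" where
  "one_minus_laplacian_pow s =
     fourier_multiplier (\<lambda>k. of_real (japanese_bracket k powr (2 * s)))"

subsection \<open>Rational subspaces and the Radon transform\<close>

definition Gr :: "nat \<Rightarrow> (rat^'n) set set" where
  "Gr d = {A. vec.subspace A \<and> vec.dim A = d}"

definition perp :: "int^'n \<Rightarrow> (rat^'n) set \<Rightarrow> bool" where
  "perp k A \<longleftrightarrow> (\<forall>v\<in>A. (\<Sum>i\<in>UNIV. of_int (k $ i) * v $ i) = 0)"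

definition integer_basis :: "nat \<Rightarrow> (rat^'n) set \<Rightarrow> (nat \<Rightarrow> int^'n) \<Rightarrow> bool" where
  "integer_basis d A v \<longleftrightarrow>
     inj_on v {..<d} \<and>
     vec.independent ((\<lambda>j. of_int_vec (v j)) ` {..<d} :: (rat^'n) set) \<and>
     vec.span ((\<lambda>j. of_int_vec (v j)) ` {..<d}) = A"

definition cube_integral :: "'i set \<Rightarrow> (('i \<Rightarrow> real) \<Rightarrow> complex) \<Rightarrow> complex" where
  "cube_integral I F = (LINT t:(\<Pi>\<^sub>E i\<in>I. {0..1})|(\<Pi>\<^sub>M i\<in>I. lborel). F t)"

definition radon ::
    "nat \<Rightarrow> (nat \<Rightarrow> int^'n) \<Rightarrow> (real^'n \<Rightarrow> complex) \<Rightarrow> real^'n \<Rightarrow> complex" where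
  "radon d v f x = cube_integral {..<d} (\<lambda>t. f (x + (\<Sum>j<d. t j *\<^sub>R of_int_vec (v j))))"

definition radon_distr ::
    "nat \<Rightarrow> (nat \<Rightarrow> int^'n) \<Rightarrow> 'n::finite functional \<Rightarrow> 'n functional" where
  "radon_distr d v u = (\<lambda>g\<in>test_fun. u (radon d v g))"

text \<open>
  The transform depends on \<open>v\<close> only through the rational span of its vectors, so any integer
  basis of \<open>A\<close> may be chosen.
\<close>

definition radon_Gr :: "nat \<Rightarrow> (rat^'n) set \<Rightarrow> (real^'n \<Rightarrow> complex) \<Rightarrow> real^'n \<Rightarrow> complex" where
  "radon_Gr d A = radon d (SOME v. integer_basis d A v)"

definition radon_distr_Gr ::
    "nat \<Rightarrow> (rat^'n) set \<Rightarrow> 'n::finite functional \<Rightarrow> 'n functional" where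
  "radon_distr_Gr d A = radon_distr d (SOME v. integer_basis d A v)"

subsection \<open>The coordinates of a rational subspace\<close>

text \<open>
  The chosen standard unit vectors are recorded by their index set \<open>I\<close>; accordingly the
  parameter \<open>T\<close> is indexed by the elements of \<open>I\<close>.
\<close>

definition coordinate_frame ::
    "nat \<Rightarrow> (rat^'n) set \<Rightarrow> (nat \<Rightarrow> int^'n) \<Rightarrow> 'n set \<Rightarrow> bool" where
  "coordinate_frame d A v I \<longleftrightarrow>
     integer_basis d A v \<and>
     card I = CARD('n) - d \<and>
     (let W = (\<lambda>j. of_int_vec (v j)) ` {..<d} :: (real^'n) set;
          E = (\<lambda>i. axis i 1) ` I
      in (\<forall>e\<in>E. e \<notin> span W) \<and> span (W \<union> E) = UNIV)"

definition coordinate_map ::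
    "nat \<Rightarrow> (nat \<Rightarrow> int^'n) \<Rightarrow> 'n set \<Rightarrow> ('n \<Rightarrow> real) \<Rightarrow> (nat \<Rightarrow> real) \<Rightarrow> real^'n" where
  "coordinate_map d v I T S =
     (\<Sum>i\<in>I. T i *\<^sub>R axis i 1) + (\<Sum>j<d. S j *\<^sub>R of_int_vec (v j))"

end

theory Submission
  imports Defs
begin

text \<open>
  Since \<open>k \<perp> A\<close>, the character of frequency \<open>-k\<close> is constant along \<open>A\<close>, so the Radon transform fixes
  it and commutes with multiplication by it; the first two equalities follow from Fubini, translation
  invariance of the torus integral and orthogonality of characters.  For the integral formula, the
  integrand \<open>F = R h \<cdot> exp (-2 \<pi> i k \<cdot> x)\<close> is invariant under translations in the real span \<open>V\<close> of \<open>A\<close>.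
  Its average over the cube spanned by the chosen unit vectors is also invariant under translations
  along these vectors by periodicity, hence constant, and it has the same torus integral as \<open>F\<close>.
  No change of variables, and hence no Jacobian, is needed.
\<close>

section \<open>Averages over segments and parallelepipeds\<close>

definition line_avg :: "'a::euclidean_space \<Rightarrow> ('a \<Rightarrow> complex) \<Rightarrow> 'a \<Rightarrow> complex" where
  "line_avg w F x = integral {0..1} (\<lambda>t. F (x + t *\<^sub>R w))"

text \<open>Common form of three integrals: the Radon transform (\<open>w\<close> an integer basis),
  the integral over \<open>T\<close> (\<open>w\<close> the chosen unit vectors) and the torus
  integral (\<open>w\<close> all unit vectors, base point 0).\<close>

definition box_avg ::
    "'i set \<Rightarrow> ('i \<Rightarrow> 'a::euclidean_space) \<Rightarrow> ('a \<Rightarrow> complex) \<Rightarrow> 'a \<Rightarrow> complex" where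
  "box_avg I w F x = cube_integral I (\<lambda>T. F (x + (\<Sum>i\<in>I. T i *\<^sub>R w i)))"

lemma continuous_on_line_avg:
  assumes "continuous_on UNIV F"
  shows "continuous_on UNIV (line_avg w F)"
proof -
  have "continuous_on (UNIV \<times> cbox 0 1) (\<lambda>(x, t::real). F (x + t *\<^sub>R w))"
    unfolding split_beta
    by (rule continuous_on_compose2[OF assms]) (auto intro!: continuous_intros)
  from integral_continuous_on_param[OF this] show ?thesis
    unfolding line_avg_def by simp
qed

lemma line_avg_periodic:
  assumes "\<And>y. F (y + p) = F y"
  shows "line_avg w F (x + p) = line_avg w F x"
proof -
  have "F (x + p + t *\<^sub>R w) = F (x + t *\<^sub>R w)" for t
    using assms[of "x + t *\<^sub>R w"] by (simp add: algebra_simps)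
  then show ?thesis unfolding line_avg_def by simp
qed

lemma line_avg_invariant:
  assumes F: "\<And>y t. F (y + t *\<^sub>R w) = F y"
  shows "line_avg w F = F"
  unfolding line_avg_def by (simp add: F fun_eq_iff)

text \<open>Along the line, \<open>F\<close> is a function of period 1, and its integral is the same
  over every interval of length 1. Thus one period \<open>w\<close> of \<open>F\<close> becomes
  invariance under all real multiples of \<open>w\<close>.\<close>

lemma line_avg_shift:
  assumes cont: "continuous_on UNIV F" and per: "\<And>y. F (y + w) = F y"
  shows "line_avg w F (x + c *\<^sub>R w) = line_avg w F x"
proof -
  define g where "g t = F (x + t *\<^sub>R w)" for t
  interpret periodic_fun_simple' g
    by unfold_locales (use per[of "x + _ *\<^sub>R w"] in \<open>simp add: g_def algebra_simps\<close>)
  have int: "g integrable_on {a..b}" for a b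
    unfolding g_def
    by (intro integrable_continuous_real continuous_on_compose2[OF cont]) (auto intro!: continuous_intros)
  have shift: "integral {a..b} (\<lambda>t. g (t + e)) = integral {a+e..b+e} g" for a b e
    using integral_shift_Icc_real[of a b g e] by (simp add: o_def add.commute)
  \<comment> \<open>Periodicity removes the integer part of \<open>c\<close>. The remaining interval
    from \<open>e\<close> to \<open>1 + e\<close> is cut at 1, and its right piece is moved back to
    start at 0.\<close>
  define e where "e = frac c"
  have e: "0 \<le> e" "e \<le> 1"
    unfolding e_def by (simp_all add: frac_lt_1 less_imp_le)
  have "g (t + c) = g (t + e)" for t
    using plus_of_int[of "t + e" "\<lfloor>c\<rfloor>"] by (simp add: e_def frac_def add.assoc)
  then have "line_avg w F (x + c *\<^sub>R w) = integral {0..1} (\<lambda>t. g (t + e))"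
    unfolding line_avg_def g_def by (simp add: algebra_simps)
  also have "\<dots> = integral {e..1 + e} g"
    by (simp add: shift)
  also have "\<dots> = integral {e..1} g + integral {1..1 + e} g"
    using e by (simp add: Henstock_Kurzweil_Integration.integral_combine[OF _ _ int])
  also have "integral {1..1 + e} g = integral {0..e} g"
    using shift[of 0 e 1] by (simp add: plus_1 add.commute)
  also have "integral {e..1} g + integral {0..e} g = integral {0..1} g"
    using e Henstock_Kurzweil_Integration.integral_combine[OF _ _ int, of 0 e 1] by (simp add: add.commute)
  also have "\<dots> = line_avg w F x"
    by (simp add: line_avg_def g_def[abs_def])
  finally show ?thesis .
qed

lemma box_avg_empty [simp]: "box_avg {} w F = F"
  unfolding box_avg_def cube_integral_def set_lebesgue_integral_def
  by (simp add: PiM_empty lebesgue_integral_count_space_finite fun_eq_iff)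

lemma integrable_box:
  assumes fin: "finite I" and cont: "continuous_on UNIV F"
  shows "set_integrable (\<Pi>\<^sub>M i\<in>I. lborel) (\<Pi>\<^sub>E i\<in>I. {0..1::real})
           (\<lambda>T. F (x + (\<Sum>i\<in>I. T i *\<^sub>R (w i :: 'a::euclidean_space))) :: complex)"
proof -
  interpret product_sigma_finite "\<lambda>_. lborel :: real measure" ..
  let ?M = "(\<Pi>\<^sub>M i\<in>I. lborel) :: ('b \<Rightarrow> real) measure" and ?S = "(\<Pi>\<^sub>E i\<in>I. {0..1::real})"
  have [measurable]: "F \<in> borel_measurable borel"
    using cont by (rule borel_measurable_continuous_onI)
  have [measurable]: "?S \<in> sets ?M"
    using fin by (intro sets_PiM_I_finite) auto
  have meas [measurable]: "(\<lambda>T. F (x + (\<Sum>i\<in>I. T i *\<^sub>R w i))) \<in> borel_measurable ?M"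
    by measurable
  \<comment> \<open>The coefficients lie between 0 and 1, so the whole parallelepiped lies in this
    compact ball, where the continuous \<open>F\<close> is bounded.\<close>
  let ?K = "cball x (\<Sum>i\<in>I. norm (w i))"
  have "bounded (F ` ?K)"
    by (intro compact_imp_bounded compact_continuous_image continuous_on_subset[OF cont]) auto
  then obtain B where B: "\<And>y. y \<in> ?K \<Longrightarrow> norm (F y) \<le> B"
    unfolding bounded_iff by blast
  have bnd: "norm (F (x + (\<Sum>i\<in>I. T i *\<^sub>R w i))) \<le> B" if "T \<in> ?S" for T
  proof (rule B)
    have "norm (\<Sum>i\<in>I. T i *\<^sub>R w i) \<le> (\<Sum>i\<in>I. norm (w i))"
      using that by (intro sum_norm_le) (auto simp: PiE_def Pi_def intro!: mult_left_le_one_le)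
    then show "x + (\<Sum>i\<in>I. T i *\<^sub>R w i) \<in> ?K"
      by (simp add: dist_norm)
  qed
  show ?thesis
    unfolding set_integrable_def
  proof (rule integrableI_bounded_set[where A = ?S and B = B])
    show "emeasure ?M ?S < \<infinity>"
      using fin by (subst emeasure_PiM) auto
  qed (use bnd in auto)
qed

text \<open>Fubini, with the new coordinate integrated first. It reduces box averages to iterated
  line averages, so their properties follow by induction on the index set.\<close>

lemma box_avg_insert:
  assumes fin: "finite I" and i: "i \<notin> I" and cont: "continuous_on UNIV F"
  shows "box_avg (insert i I) w F = box_avg I w (line_avg (w i) F)"
proof
  fix x
  interpret product_sigma_finite "\<lambda>_. lborel :: real measure" ..
  let ?S = "\<lambda>I. (\<Pi>\<^sub>E i\<in>I. {0..1::real})"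
  let ?G = "\<lambda>T. F (x + (\<Sum>i\<in>insert i I. T i *\<^sub>R w i))"
  \<comment> \<open>Points of the product space are already extensional outside \<open>I\<close>, so
    membership in the larger cube splits into conditions on \<open>T\<close> and on
    \<open>t\<close>.\<close>
  have ind: "indicator (?S (insert i I)) (T(i := t)) = indicator (?S I) T * (indicator {0..1} t :: real)"
    if "T \<in> space (Pi\<^sub>M I (\<lambda>_. lborel :: real measure))" for T t
    using that i by (auto simp: indicator_def space_PiM PiE_def Pi_def extensional_def)
  have G: "?G (T(i := t)) = F ((x + (\<Sum>i\<in>I. T i *\<^sub>R w i)) + t *\<^sub>R w i)" for T t
  proof -
    have "(\<Sum>j\<in>I. (T(i := t)) j *\<^sub>R w j) = (\<Sum>j\<in>I. T j *\<^sub>R w j)"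
      using i by (intro sum.cong) auto
    then show ?thesis using fin i by (simp add: algebra_simps)
  qed
  have line: "(LINT t:{0..1}|lborel. F (y + t *\<^sub>R w i)) = line_avg (w i) F y" for y
    unfolding line_avg_def
    by (rule set_borel_integral_eq_integral, rule borel_integrable_atLeastAtMost',
        rule continuous_on_compose2[OF cont]) (auto intro!: continuous_intros)
  have "box_avg (insert i I) w F x
      = (LINT T|(\<Pi>\<^sub>M i\<in>I. lborel). LINT t|lborel.
           indicator (?S (insert i I)) (T(i := t)) *\<^sub>R ?G (T(i := t)))"
    unfolding box_avg_def cube_integral_def set_lebesgue_integral_def
    using integrable_box[OF _ cont, of "insert i I" x w] fin i
    by (intro product_integral_insert) (auto simp: set_integrable_def)
  also have "\<dots> = (LINT T|(\<Pi>\<^sub>M i\<in>I. lborel).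
      indicator (?S I) T *\<^sub>R line_avg (w i) F (x + (\<Sum>i\<in>I. T i *\<^sub>R w i)))"
  proof (rule Bochner_Integration.integral_cong[OF refl])
    fix T assume T: "T \<in> space (Pi\<^sub>M I (\<lambda>_. lborel :: real measure))"
    have "(LINT t|lborel. indicator (?S (insert i I)) (T(i := t)) *\<^sub>R ?G (T(i := t)))
      = indicator (?S I) T *\<^sub>R (LINT t:{0..1}|lborel. F ((x + (\<Sum>i\<in>I. T i *\<^sub>R w i)) + t *\<^sub>R w i))"
      unfolding ind[OF T] G set_lebesgue_integral_def
        scaleR_scaleR[symmetric] integral_scaleR_right ..
    then show "(LINT t|lborel. indicator (?S (insert i I)) (T(i := t)) *\<^sub>R ?G (T(i := t)))
      = indicator (?S I) T *\<^sub>R line_avg (w i) F (x + (\<Sum>i\<in>I. T i *\<^sub>R w i))"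
      by (simp only: line)
  qed
  finally show "box_avg (insert i I) w F x = box_avg I w (line_avg (w i) F) x"
    unfolding box_avg_def cube_integral_def set_lebesgue_integral_def .
qed

lemma continuous_on_box_avg:
  assumes "finite I" "continuous_on UNIV F"
  shows "continuous_on UNIV (box_avg I w F)"
  using assms
  by (induction I arbitrary: F rule: finite_induct)
     (simp_all add: box_avg_insert continuous_on_line_avg)

text \<open>Averaging commutes with translations. Here \<open>p\<close> may be a lattice vector or
  any vector of a subspace along which \<open>F\<close> is constant.\<close>

lemma box_avg_periodic:
  assumes "\<And>y. F (y + p) = F y"
  shows "box_avg I w F (x + p) = box_avg I w F x"
proof -
  have "F (x + p + z) = F (x + z)" for z
    using assms[of "x + z"] by (simp add: algebra_simps)
  then show ?thesis unfolding box_avg_def by simp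
qed

lemma box_avg_invariant:
  assumes "finite I" "continuous_on UNIV F" "\<And>i y t. i \<in> I \<Longrightarrow> F (y + t *\<^sub>R w i) = F y"
  shows "box_avg I w F = F"
  using assms
  by (induction I rule: finite_induct) (simp_all add: box_avg_insert line_avg_invariant)

text \<open>In direction \<open>w i\<close> the invariance comes from the innermost average by
  \<open>line_avg_shift\<close> and survives the outer ones. For another direction, the inner line
  average keeps the periods of \<open>F\<close>, so the induction hypothesis applies to it.\<close>

lemma box_avg_shift:
  assumes "finite I" "continuous_on UNIV F" "\<And>i y. i \<in> I \<Longrightarrow> F (y + w i) = F y" "j \<in> I"
  shows "box_avg I w F (x + c *\<^sub>R w j) = box_avg I w F x"
  using assms
proof (induction I arbitrary: F rule: finite_induct)
  case (insert i I)
  have eq: "box_avg (insert i I) w F = box_avg I w (line_avg (w i) F)"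
    using insert by (intro box_avg_insert) auto
  show ?case
  proof (cases "j = i")
    case True
    then show ?thesis
      unfolding eq using insert.prems by (auto intro!: box_avg_periodic line_avg_shift)
  next
    case False
    then show ?thesis
      unfolding eq using insert.prems
      by (intro insert.IH continuous_on_line_avg line_avg_periodic) auto
  qed
qed simp

section \<open>The torus integral as a box average, and its invariance\<close>

lemma sum_axis_nth: "(\<Sum>i\<in>UNIV. T i *\<^sub>R axis i (1::real)) $ j = T j"
  for T :: "'n::finite \<Rightarrow> real"
  by (simp add: axis_def if_distrib[of "\<lambda>x. _ * x"] cong: if_cong)

text \<open>Lebesgue measure is determined by its values on boxes, and the image of the product
  measure gives a box the product of its side lengths. This links integrals over
  \<open>real^'n\<close> with \<open>cube_integral\<close>.\<close>

lemma lborel_eq_distr_PiM: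
  "(lborel :: (real^'n) measure) =
     distr (\<Pi>\<^sub>M i\<in>UNIV. lborel) borel (\<lambda>T. \<Sum>i\<in>UNIV. T i *\<^sub>R axis i 1)"
proof (rule lborel_eqI)
  interpret product_sigma_finite "\<lambda>_. lborel :: real measure" ..
  fix l u :: "real^'n"
  assume lu: "\<And>b. b \<in> Basis \<Longrightarrow> l \<bullet> b \<le> u \<bullet> b"
  have le: "l $ i \<le> u $ i" for i
    using lu[of "axis i 1"] by (simp add: inner_axis axis_in_Basis_iff)
  have [measurable]: "(\<lambda>T. \<Sum>i\<in>UNIV. T i *\<^sub>R axis i (1::real) :: real^'n)
      \<in> borel_measurable (\<Pi>\<^sub>M i\<in>UNIV. lborel)"
    by measurable
  have "(\<lambda>T. \<Sum>i\<in>UNIV. T i *\<^sub>R axis i 1) -` box l u \<inter> space (\<Pi>\<^sub>M i\<in>UNIV. lborel)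
      = (\<Pi>\<^sub>E i\<in>UNIV. {l $ i<..<u $ i})"
    by (auto simp: mem_box_cart sum_axis_nth space_PiM PiE_def Pi_def simp del: sum_component)
  then have "emeasure (distr (\<Pi>\<^sub>M i\<in>UNIV. lborel) borel (\<lambda>T. \<Sum>i\<in>UNIV. T i *\<^sub>R axis i 1)) (box l u)
      = emeasure (\<Pi>\<^sub>M i\<in>UNIV. lborel) (\<Pi>\<^sub>E i\<in>UNIV. {l $ i<..<u $ i})"
    by (subst emeasure_distr) auto
  also have "\<dots> = (\<Prod>i\<in>UNIV. ennreal (u $ i - l $ i))"
    by (subst emeasure_PiM) (auto simp: le)
  also have "\<dots> = ennreal (\<Prod>i\<in>UNIV. u $ i - l $ i)"
    by (rule prod_ennreal) (simp add: le)
  also have "(\<Prod>i\<in>UNIV. u $ i - l $ i) = (\<Prod>b\<in>Basis. (u - l) \<bullet> b)"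
  proof -
    have "Basis = (\<lambda>i. axis i 1 :: real^'n) ` UNIV"
      by (auto simp: Basis_vec_def)
    then show ?thesis
      unfolding \<open>Basis = _\<close>
      by (simp add: prod.reindex inj_on_def axis_eq_axis inner_axis)
  qed
  finally show "emeasure (distr (\<Pi>\<^sub>M i\<in>UNIV. lborel) borel (\<lambda>T. \<Sum>i\<in>UNIV. T i *\<^sub>R axis i 1)) (box l u)
      = (\<Prod>b\<in>Basis. (u - l) \<bullet> b)" .
qed simp

lemma torus_integral_eq_box_avg:
  fixes F :: "real^'n \<Rightarrow> complex"
  assumes "continuous_on UNIV F"
  shows "torus_integral F = box_avg UNIV (\<lambda>i. axis i 1) F 0"
proof -
  have [measurable]: "F \<in> borel_measurable borel"
    using assms by (rule borel_measurable_continuous_onI)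
  have [measurable]: "(\<lambda>T. \<Sum>i\<in>UNIV. T i *\<^sub>R axis i (1::real) :: real^'n)
      \<in> borel_measurable (\<Pi>\<^sub>M i\<in>UNIV. lborel)"
    by measurable
  \<comment> \<open>Over the index set \<open>UNIV\<close> extensionality is vacuous, so the two
    indicators agree for every \<open>T\<close>.\<close>
  have ind: "indicator (cbox 0 1) (\<Sum>i\<in>UNIV. T i *\<^sub>R axis i (1::real))
      = (indicator (\<Pi>\<^sub>E i\<in>(UNIV::'n set). {0..1}) T :: real)" for T
    by (auto simp: indicator_def mem_box_cart sum_axis_nth PiE_def simp del: sum_component)
  show ?thesis
    unfolding torus_integral_def set_lebesgue_integral_def box_avg_def cube_integral_def
    by (subst lborel_eq_distr_PiM, subst integral_distr) (simp_all add: ind)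
qed

lemma torus_integral_eq_integral:
  fixes F :: "real^'n \<Rightarrow> complex"
  assumes "continuous_on UNIV F"
  shows "torus_integral F = integral (cbox 0 1) F"
  unfolding torus_integral_def
  by (rule set_borel_integral_eq_integral)
     (auto simp: set_integrable_def intro!: borel_integrable_compact continuous_on_subset[OF assms])

lemma axis_span_UNIV: "span (range (\<lambda>i. axis i 1 :: real^'n)) = UNIV"
proof -
  have "Basis = range (\<lambda>i. axis i 1 :: real^'n)"
    by (auto simp: Basis_vec_def)
  then show ?thesis using span_Basis by metis
qed

lemma translation_invariant_span:
  fixes F :: "'a::real_vector \<Rightarrow> 'b"
  assumes "p \<in> span W" "\<And>w c x. w \<in> W \<Longrightarrow> F (x + c *\<^sub>R w) = F x"
  shows "F (x + p) = F x"
proof -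
  \<comment> \<open>With all multiples \<open>c\<close> included, the property defines a subspace of
    vectors \<open>p\<close>, so span induction applies.\<close>
  have "\<forall>c x. F (x + c *\<^sub>R p) = F x"
    using assms(1)
  proof (induction rule: span_induct)
    case base
    show ?case
      unfolding subspace_def by (auto simp: scaleR_add_right add.assoc[symmetric])
  qed (use assms(2) in auto)
  from this[rule_format, of x 1] show ?thesis by simp
qed

lemma periodic_axis:
  fixes F :: "real^'n \<Rightarrow> complex"
  assumes "periodic F"
  shows "F (x + axis i 1) = F x"
proof -
  have "of_int_vec (axis i 1) = (axis i 1 :: real^'n)"
    by (auto simp: of_int_vec_def axis_def vec_eq_iff)
  then show ?thesis using assms unfolding periodic_def by metis
qed

text \<open>Translating by \<open>c\<close> moves the base point of the box average from 0 to
  \<open>c\<close>. That average is invariant along every unit vector, hence constant.\<close>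

lemma torus_integral_translate:
  fixes F :: "real^'n \<Rightarrow> complex"
  assumes cont: "continuous_on UNIV F" and per: "periodic F"
  shows "torus_integral (\<lambda>x. F (x + c)) = torus_integral F"
proof -
  let ?avg = "box_avg UNIV (\<lambda>i. axis i 1) F"
  have "continuous_on UNIV (\<lambda>x. F (x + c))"
    by (rule continuous_on_compose2[OF cont]) (auto intro!: continuous_intros)
  then have "torus_integral (\<lambda>x. F (x + c)) = ?avg (0 + c)"
    unfolding torus_integral_eq_box_avg[OF \<open>continuous_on UNIV (\<lambda>x. F (x + c))\<close>]
    by (simp add: box_avg_def add_ac)
  also have "\<dots> = ?avg 0"
  proof (rule translation_invariant_span)
    show "c \<in> span (range (\<lambda>i. axis i 1))"
      by (simp add: axis_span_UNIV)
  qed (auto intro!: box_avg_shift cont periodic_axis per)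
  finally show ?thesis by (simp add: torus_integral_eq_box_avg cont)
qed

text \<open>After exchanging the integrals, each inner one is the torus integral of a translate of
  \<open>F\<close>.\<close>

lemma torus_integral_line_avg:
  fixes F :: "real^'n \<Rightarrow> complex"
  assumes cont: "continuous_on UNIV F" and per: "periodic F"
  shows "torus_integral (line_avg w F) = torus_integral F"
proof -
  have "torus_integral (line_avg w F)
      = integral (cbox 0 1) (\<lambda>x. integral (cbox (0::real) 1) (\<lambda>t. F (x + t *\<^sub>R w)))"
    unfolding torus_integral_eq_integral[OF continuous_on_line_avg[OF cont]]
    by (simp add: line_avg_def[abs_def])
  also have "\<dots> = integral (cbox (0::real) 1) (\<lambda>t. integral (cbox 0 1) (\<lambda>x. F (x + t *\<^sub>R w)))"
    unfolding split_beta
    by (rule integral_swap_continuous, unfold split_beta, rule continuous_on_compose2[OF cont])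
       (auto intro!: continuous_intros)
  also have "\<dots> = integral (cbox (0::real) 1) (\<lambda>t. torus_integral F)"
  proof (rule Henstock_Kurzweil_Integration.integral_cong)
    fix t
    have "continuous_on UNIV (\<lambda>x. F (x + t *\<^sub>R w))"
      by (rule continuous_on_compose2[OF cont]) (auto intro!: continuous_intros)
    then show "integral (cbox 0 1) (\<lambda>x. F (x + t *\<^sub>R w)) = torus_integral F"
      using torus_integral_translate[OF cont per, of "t *\<^sub>R w"]
      by (simp add: torus_integral_eq_integral)
  qed
  finally show ?thesis by simp
qed

lemma torus_integral_box_avg:
  fixes F :: "real^'n \<Rightarrow> complex"
  assumes "finite I" "continuous_on UNIV F" "periodic F"
  shows "torus_integral (box_avg I w F) = torus_integral F"
  using assms
proof (induction I arbitrary: F rule: finite_induct)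
  case (insert i I)
  have "periodic (line_avg (w i) F)"
    using insert.prems unfolding periodic_def by (auto intro!: line_avg_periodic)
  then show ?case
    using insert by (simp add: box_avg_insert continuous_on_line_avg torus_integral_line_avg)
qed simp

lemma torus_integral_const [simp]: "torus_integral (\<lambda>_::real^'n. c) = c"
  by (subst torus_integral_eq_box_avg, simp, subst box_avg_invariant) auto

section \<open>Characters, their orthogonality and Fourier multipliers\<close>

lemma character_add: "character k (x + y) = character k x * character k y"
  unfolding character_def by (simp add: inner_add_right ring_distribs exp_add)

lemma of_int_vec_add: "of_int_vec (k + l) = of_int_vec k + of_int_vec l"
  by (simp add: of_int_vec_def vec_eq_iff)

lemma of_int_vec_minus: "of_int_vec (- k) = - of_int_vec k"
  by (simp add: of_int_vec_def vec_eq_iff)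

lemma character_mult: "character k x * character l x = character (k + l) x"
  unfolding character_def by (simp add: of_int_vec_add inner_add_left ring_distribs exp_add)

lemma character_0 [simp]: "character 0 = (\<lambda>_. 1)"
  by (auto simp: character_def of_int_vec_def inner_vec_def)

lemma character_eq_1:
  assumes "of_int_vec k \<bullet> x \<in> \<int>"
  shows "character k x = 1"
proof -
  obtain n where "of_int_vec k \<bullet> x = of_int n" using assms by (auto elim: Ints_cases)
  then show ?thesis
    using exp_integer_2pi[of "of_int n"] by (simp add: character_def mult_ac)
qed

lemma periodic_character: "periodic (character k)"
proof -
  have "of_int_vec k \<bullet> (of_int_vec m :: real^'a) \<in> \<int>" for m
    unfolding inner_vec_def of_int_vec_def by auto
  then show ?thesis
    unfolding periodic_def by (simp add: character_add character_eq_1)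
qed

lemma has_derivative_character:
  "((\<lambda>x. c * character k x) has_derivative
     (\<lambda>v. c * character k x * (2 * of_real pi * \<i> * of_real (of_int_vec k \<bullet> v)))) (at x)"
proof -
  have "((\<lambda>x. 2 * of_real pi * \<i> * of_real (of_int_vec k \<bullet> x)) has_derivative
      (\<lambda>v. 2 * of_real pi * \<i> * of_real (of_int_vec k \<bullet> v))) (at x)"
    by (intro derivative_intros)
  from has_derivative_mult_right[OF has_derivative_compose[OF this
        DERIV_exp[unfolded has_field_derivative_def]], of c]
  show ?thesis unfolding character_def by (simp add: mult_ac)
qed

lemma continuous_on_character [continuous_intros]: "continuous_on S (character k)"
  unfolding character_def by (intro continuous_intros)

lemma iter_deriv_character: "\<exists>c. iter_deriv is (character k) = (\<lambda>x. c * character k x)"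
proof (induction "is")
  case Nil
  show ?case by (rule exI[of _ 1]) (simp add: iter_deriv_def)
next
  case (Cons i "is")
  then obtain c where c: "iter_deriv is (character k) = (\<lambda>x. c * character k x)" by auto
  have "iter_deriv (i # is) (character k) = partial_deriv i (\<lambda>x. c * character k x)"
    by (simp add: iter_deriv_def flip: c)
  also have "\<dots> = (\<lambda>x. (c * (2 * of_real pi * \<i> * of_real (of_int_vec k \<bullet> axis i (1::real)))) * character k x)"
    unfolding partial_deriv_def
    by (simp add: frechet_derivative_at[OF has_derivative_character, symmetric] mult_ac)
  finally show ?case by blast
qed

text \<open>Functionals such as \<open>distr_of h\<close> are restricted to \<open>test_fun\<close>
  and are \<open>undefined\<close> elsewhere, so this membership is what allows a Fourier
  coefficient to be unfolded.\<close>

lemma character_test_fun [simp]: "character k \<in> test_fun"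
proof -
  have "iter_deriv is (character k) differentiable at x" for "is" x
    using iter_deriv_character[of "is" k] has_derivative_character[of _ k x]
    by (metis differentiableI)
  then show ?thesis
    by (simp add: test_fun_def smooth_def periodic_character)
qed

lemma torus_integral_mult_left:
  "torus_integral (\<lambda>x. c * F x) = c * torus_integral F"
  unfolding torus_integral_def by simp

lemma torus_integral_character: "torus_integral (character k) = (if k = 0 then 1 else 0)"
proof (cases "k = 0")
  case False
  then obtain i where i: "k $ i \<noteq> 0" by (auto simp: vec_eq_iff)
  \<comment> \<open>Half a period in a coordinate where \<open>k\<close> does not vanish:
    translation by \<open>p\<close> changes the sign of the character, so its integral equals its
    own negative.\<close>
  define p :: "real^'a" where "p = axis i (1 / (2 * of_int (k $ i)))"
  have half: "of_int_vec k \<bullet> p = 1 / 2"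
    using i by (simp add: p_def inner_axis of_int_vec_def)
  have "2 * of_real pi * \<i> * of_real (1 / 2) = of_real pi * \<i>" by simp
  then have p: "character k p = -1"
    unfolding character_def half using exp_pi_i by (simp only:)
  have "torus_integral (character k) = torus_integral (\<lambda>x. character k (x + p))"
    by (intro torus_integral_translate[symmetric] periodic_character continuous_intros)
  also have "\<dots> = - torus_integral (character k)"
    using torus_integral_mult_left[of "-1" "character k"] by (simp add: character_add p)
  finally show ?thesis using False by simp
qed simp

lemma fourier_coeff_distr_of:
  "fourier_coeff (distr_of h) k = torus_integral (\<lambda>x. h x * character (- k) x)"
  by (simp add: fourier_coeff_def distr_of_def)

text \<open>Paired with \<open>character (- k)\<close>, the weakly evaluated series loses every term
  except \<open>l = k\<close> by orthogonality, so the infinite sum becomes a single term.\<close>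

lemma fourier_coeff_multiplier:
  "fourier_coeff (fourier_multiplier m u) k = m k * fourier_coeff u k"
proof -
  have "fourier_coeff (fourier_multiplier m u) k =
      (\<Sum>\<^sub>\<infinity>l. m l * fourier_coeff u l * torus_integral (character (l - k)))"
    unfolding fourier_coeff_def[of "fourier_multiplier m u"]
    unfolding fourier_multiplier_def distr_of_def
      restrict_apply'[OF character_test_fun] character_mult diff_conv_add_uminus ..
  also have "\<dots> = (\<Sum>\<^sub>\<infinity>l\<in>{k}. m l * fourier_coeff u l * torus_integral (character (l - k)))"
    by (rule infsum_cong_neutral) (auto simp: torus_integral_character)
  finally show ?thesis by simp
qed

section \<open>Integer bases of rational subspaces\<close>

lemma integer_basis_exists:
  assumes "A \<in> Gr d"
  shows "\<exists>v. integer_basis d A v"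
proof -
  from assms have A: "vec.subspace A" "vec.dim A = d" by (auto simp: Gr_def)
  obtain B where B: "B \<subseteq> A" "vec.independent B" "A \<subseteq> vec.span B" "card B = d"
    using vec.basis_exists[of A] A by metis
  have "finite B" using B(2) vec.finiteI_independent by blast
  then obtain b where b: "bij_betw b {..<d} B"
    using B(4) finite_same_card_bij[of "{..<d}" B] by auto
  have "\<exists>N m. N \<noteq> (0::rat) \<and> of_int_vec m = N *s x" for x :: "rat^'a"
  proof -
    \<comment> \<open>The product of all denominators of the coordinates of \<open>x\<close> is a
      nonzero integer that makes \<open>x\<close> integral.\<close>
    define N where "N = (\<Prod>i\<in>UNIV. snd (quotient_of (x $ i)))"
    have "N \<noteq> 0" unfolding N_def
      by (auto simp: prod_zero_iff) (metis less_irrefl quotient_of_denom_pos')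
    have "\<exists>z::int. of_int z = of_int N * x $ i" for i
    proof -
      obtain a c where ac: "quotient_of (x $ i) = (a, c)" by fastforce
      have "c \<noteq> 0" using quotient_of_denom_pos[OF ac] by simp
      have "N = c * (\<Prod>j\<in>UNIV - {i}. snd (quotient_of (x $ j)))"
        unfolding N_def using ac by (subst prod.remove[of _ i]) auto
      then have "of_int N * x $ i = of_int (a * (\<Prod>j\<in>UNIV - {i}. snd (quotient_of (x $ j))))"
        using quotient_of_div[OF ac] \<open>c \<noteq> 0\<close> by simp
      then show ?thesis by metis
    qed
    then obtain z where "\<And>i. of_int (z i) = of_int N * x $ i" by metis
    then have "of_int_vec (\<chi> i. z i) = of_int N *s x"
      by (simp add: of_int_vec_def vec_eq_iff)
    then show ?thesis using \<open>N \<noteq> 0\<close> of_int_eq_0_iff by blast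
  qed
  then obtain N m where Nm: "\<And>x::rat^'a. N x \<noteq> (0::rat)" "\<And>x. of_int_vec (m x) = N x *s x"
    by metis
  define v where "v j = m (b j)" for j
  let ?W = "(\<lambda>j. of_int_vec (v j)) ` {..<d} :: (rat^'a) set"
  have bA: "b j \<in> A" if "j < d" for j using b B(1) that by (auto simp: bij_betw_def)
  have W_A: "?W \<subseteq> A"
    using bA vec.subspace_scale[OF A(1)] by (auto simp: v_def Nm)
  have "B \<subseteq> vec.span ?W"
  proof
    fix x assume "x \<in> B"
    then obtain j where j: "j < d" "x = b j" using b by (auto simp: bij_betw_def)
    then have "x = (1 / N x) *s of_int_vec (v j)"
      using Nm by (simp add: v_def vec.scale_scale)
    then show "x \<in> vec.span ?W"
      using j(1) by (metis imageI lessThan_iff vec.span_base vec.span_scale)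
  qed
  then have A_W: "A \<subseteq> vec.span ?W"
    using B(3) vec.span_minimal[OF _ vec.subspace_span] by blast
  \<comment> \<open>At most \<open>d\<close> vectors spanning a space of dimension \<open>d\<close>
    are independent; there are then exactly \<open>d\<close> of them, which gives injectivity of
    \<open>v\<close>.\<close>
  have ind: "vec.independent ?W"
    using vec.card_le_dim_spanning[OF W_A A_W] card_image_le[of "{..<d}"] A(2) by auto
  have "card ?W = d"
    using vec.dim_eq_card[of ?W A] A_W W_A vec.span_minimal[OF W_A A(1)] A ind
    by (metis vec.span_eq_iff subset_antisym)
  then have "inj_on (\<lambda>j. of_int_vec (v j) :: rat^'a) {..<d}"
    by (intro eq_card_imp_inj_on) auto
  then have "inj_on v {..<d}"
    by (auto simp: inj_on_def)
  moreover have "vec.span ?W = A"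
    using A_W vec.span_minimal[OF W_A A(1)] by blast
  ultimately show ?thesis using ind unfolding integer_basis_def by blast
qed

text \<open>The coordinatewise embedding \<open>r\<close> is additive and carries rational scaling
  to real scaling. This serves to compare the real spans of two integer bases of the same
  \<open>A\<close>.\<close>

lemma real_span_of_rat_span:
  fixes V :: "(int^'n) set"
  assumes "(of_int_vec m :: rat^'n) \<in> vec.span (of_int_vec ` V)"
  shows "(of_int_vec m :: real^'n) \<in> span (of_int_vec ` V)"
proof -
  define r :: "rat^'n \<Rightarrow> real^'n" where "r x = (\<chi> i. of_rat (x $ i))" for x
  have r: "r (of_int_vec k) = of_int_vec k" for k
    by (simp add: r_def of_int_vec_def vec_eq_iff)
  have "r (of_int_vec m) \<in> span (of_int_vec ` V)"
    using assms
  proof (induction rule: vec.span_induct)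
    case base
    have "r 0 = 0" "r (x + y) = r x + r y" "r (c *s x) = of_rat c *\<^sub>R r x" for x y c
      by (simp_all add: r_def vec_eq_iff of_rat_add of_rat_mult)
    then show ?case
      by (auto simp: vec.subspace_def intro: span_add span_scale span_zero)
  next
    case (step x)
    then show ?case by (auto simp: r intro: span_base)
  qed
  then show ?thesis by (simp add: r)
qed

section \<open>The Radon transform at frequencies perpendicular to \<open>A\<close>\<close>

lemma radon_eq_box_avg: "radon d v h = box_avg {..<d} (\<lambda>j. of_int_vec (v j)) h"
  by (simp add: radon_def box_avg_def fun_eq_iff)

lemma perp_inner:
  assumes "perp k A" "of_int_vec m \<in> A"
  shows "of_int_vec k \<bullet> (of_int_vec m :: real^'n) = 0"
proof -
  \<comment> \<open>Both dot products are images of one integer sum, so vanishing passes from the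
    rationals to the reals.\<close>
  have "of_int (\<Sum>i\<in>UNIV. k $ i * m $ i) = (0::rat)"
    using assms by (auto simp: perp_def of_int_vec_def)
  then have "of_int (\<Sum>i\<in>UNIV. k $ i * m $ i) = (0::real)"
    by (simp only: of_int_eq_0_iff)
  then show ?thesis
    by (simp add: inner_vec_def of_int_vec_def)
qed

lemma integer_basis_mem:
  assumes "integer_basis d A v" "j < d"
  shows "of_int_vec (v j) \<in> A"
  using assms unfolding integer_basis_def by (metis imageI lessThan_iff vec.span_base)

context
  fixes d :: nat and A :: "(rat^'n) set" and v :: "nat \<Rightarrow> int^'n" and k :: "int^'n"
  assumes v: "integer_basis d A v" and perp: "perp k A"
begin

lemma character_span:
  assumes "p \<in> span ((\<lambda>j. of_int_vec (v j)) ` {..<d})"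
  shows "character (- k) (x + p) = character (- k) x"
  using assms
proof (rule translation_invariant_span)
  fix w c x
  assume "w \<in> (\<lambda>j. of_int_vec (v j) :: real^'n) ` {..<d}"
  then have "of_int_vec k \<bullet> w = 0"
    using perp_inner[OF perp integer_basis_mem[OF v]] by auto
  then show "character (- k) (x + c *\<^sub>R w) = character (- k) x"
    by (simp add: character_add character_eq_1 of_int_vec_minus)
qed

lemma radon_mult_character:
  "radon d v (\<lambda>x. g x * character (- k) x) = (\<lambda>x. radon d v g x * character (- k) x)"
proof
  fix x
  have "character (- k) (x + (\<Sum>j<d. t j *\<^sub>R of_int_vec (v j))) = character (- k) x" for t
    by (intro character_span span_sum span_scale span_base) auto
  then show "radon d v (\<lambda>x. g x * character (- k) x) x = radon d v g x * character (- k) x"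
    by (simp add: radon_def cube_integral_def)
qed

text \<open>The Radon transform of a distribution is defined by duality; this says that the test
  function giving the coefficient at \<open>k\<close> is left unchanged.\<close>

lemma radon_character: "radon d v (character (- k)) = character (- k)"
  unfolding radon_eq_box_avg
proof (rule box_avg_invariant)
  show "character (- k) (y + t *\<^sub>R of_int_vec (v i)) = character (- k) y" if "i \<in> {..<d}" for i y t
    using that by (intro character_span span_scale span_base) auto
qed (auto intro: continuous_intros)

end

lemma torus_continuous_mult_character:
  assumes "h \<in> torus_continuous"
  shows "(\<lambda>x. h x * character k x) \<in> torus_continuous"
proof -
  have "continuous_on UNIV h" "periodic h"
    using assms by (simp_all add: torus_continuous_def)
  then show ?thesis
    using periodic_character[of k] unfolding torus_continuous_def
    by (simp add: periodic_def continuous_on_mult continuous_on_character)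
qed

text \<open>The character can be moved inside the Radon transform, which is a box average and so
  preserves the torus integral.\<close>

lemma fourier_coeff_radon:
  assumes "integer_basis d A v" "perp k A" "h \<in> torus_continuous"
  shows "fourier_coeff (distr_of (radon d v h)) k = fourier_coeff (distr_of h) k"
  unfolding fourier_coeff_distr_of radon_mult_character[OF assms(1,2), symmetric]
  unfolding radon_eq_box_avg
  using torus_continuous_mult_character[OF assms(3), of "- k"]
  by (intro torus_integral_box_avg) (simp_all add: torus_continuous_def)

lemma radon_torus_continuous:
  assumes "h \<in> torus_continuous"
  shows "radon d v h \<in> torus_continuous"
proof -
  have "continuous_on UNIV h" "periodic h"
    using assms by (simp_all add: torus_continuous_def)
  then show ?thesis
    unfolding radon_eq_box_avg torus_continuous_def periodic_def
    by (simp add: continuous_on_box_avg box_avg_periodic)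
qed

text \<open>Each integer vector \<open>v j\<close> is a period of \<open>h\<close>, and averaging
  along it yields invariance under its real multiples.\<close>

lemma radon_span:
  fixes h :: "real^'n \<Rightarrow> complex"
  assumes h: "h \<in> torus_continuous"
    and p: "p \<in> span ((\<lambda>j. of_int_vec (v j)) ` {..<d})"
  shows "radon d v h (x + p) = radon d v h x"
  using p
proof (rule translation_invariant_span)
  fix w c x
  assume "w \<in> (\<lambda>j. of_int_vec (v j) :: real^'n) ` {..<d}"
  then obtain j where j: "j < d" "w = of_int_vec (v j)" by auto
  show "radon d v h (x + c *\<^sub>R w) = radon d v h x"
    unfolding radon_eq_box_avg j(2)
    by (rule box_avg_shift) (use h j(1) in \<open>auto simp: torus_continuous_def periodic_def\<close>)
qed

text \<open>Two integer bases of \<open>A\<close> occur: \<open>v\<close> defines the transform,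
  while \<open>v'\<close> belongs to the coordinate frame and may be different.\<close>

lemma fourier_coeff_radon_frame:
  fixes h :: "real^'n \<Rightarrow> complex"
  assumes v: "integer_basis d A v" and perp: "perp k A" and h: "h \<in> torus_continuous"
    and frame: "coordinate_frame d A v' I"
  shows "fourier_coeff (distr_of (radon d v h)) k
    = cube_integral I (\<lambda>T. radon d v h (coordinate_map d v' I T (\<lambda>_. 0)) *
        exp (- 2 * of_real pi * \<i> * of_real (\<Sum>i\<in>I. of_int (k $ i) * T i)))"
proof -
  define F where "F x = radon d v h x * character (- k) x" for x
  define W W' :: "(real^'n) set" where "W = (\<lambda>j. of_int_vec (v j)) ` {..<d}"
    and "W' = (\<lambda>j. of_int_vec (v' j)) ` {..<d}"
  let ?e = "\<lambda>i. axis i 1 :: real^'n"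
  have "F \<in> torus_continuous"
    unfolding F_def[abs_def] by (rule torus_continuous_mult_character[OF radon_torus_continuous[OF h]])
  then have F_cont: "continuous_on UNIV F" and F_per: "periodic F"
    by (auto simp: torus_continuous_def)
  have F_W: "F (x + p) = F x" if "p \<in> span W" for x p
    using that unfolding F_def W_def by (simp add: radon_span[OF h] character_span[OF v perp])
  have v': "integer_basis d A v'" and span: "span (W' \<union> ?e ` I) = UNIV"
    using frame unfolding coordinate_frame_def Let_def W'_def by auto
  \<comment> \<open>Invariance of \<open>F\<close> is known along \<open>W\<close>, but the frame
    spans the whole space with the help of \<open>W'\<close>; this inclusion bridges the
    two.\<close>
  have W': "W' \<subseteq> span W"
  proof
    fix w assume "w \<in> W'"
    then obtain j where j: "j < d" "w = of_int_vec (v' j)" by (auto simp: W'_def)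
    have "of_int_vec (v' j) \<in> vec.span (of_int_vec ` v ` {..<d} :: (rat^'n) set)"
      using integer_basis_mem[OF v' j(1)] v by (auto simp: integer_basis_def image_image)
    from real_span_of_rat_span[OF this] show "w \<in> span W"
      by (simp add: W_def j(2) image_image)
  qed
  have const: "box_avg I ?e F x = box_avg I ?e F 0" for x
  proof -
    have "box_avg I ?e F (0 + x) = box_avg I ?e F 0"
    proof (rule translation_invariant_span)
      show "x \<in> span (W' \<union> ?e ` I)" by (simp add: span)
      fix w c y assume "w \<in> W' \<union> ?e ` I"
      then show "box_avg I ?e F (y + c *\<^sub>R w) = box_avg I ?e F y"
      proof
        assume "w \<in> W'"
        then show ?thesis
          using W' by (intro box_avg_periodic F_W span_scale) auto
      next
        assume "w \<in> ?e ` I"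
        then show ?thesis
          by (auto intro!: box_avg_shift F_cont periodic_axis F_per)
      qed
    qed
    then show ?thesis by simp
  qed
  have "fourier_coeff (distr_of (radon d v h)) k = torus_integral F"
    by (simp add: fourier_coeff_distr_of F_def[abs_def])
  also have "\<dots> = torus_integral (box_avg I ?e F)"
    by (intro torus_integral_box_avg[symmetric] F_cont F_per) simp
  \<comment> \<open>The average is constant, and the torus has volume 1.\<close>
  also have "\<dots> = box_avg I ?e F 0"
    using const torus_integral_const[of "box_avg I ?e F 0"] by (metis (no_types, lifting) ext)
  also have "\<dots> = cube_integral I (\<lambda>T. radon d v h (coordinate_map d v' I T (\<lambda>_. 0)) *
        exp (- 2 * of_real pi * \<i> * of_real (\<Sum>i\<in>I. of_int (k $ i) * T i)))"
  proof -
    have "character (- k) (\<Sum>i\<in>I. T i *\<^sub>R ?e i)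
        = exp (- 2 * of_real pi * \<i> * of_real (\<Sum>i\<in>I. of_int (k $ i) * T i))" for T
    proof -
      have "of_int_vec (- k) \<bullet> (\<Sum>i\<in>I. T i *\<^sub>R ?e i) = - (\<Sum>i\<in>I. of_int (k $ i) * T i)"
        unfolding of_int_vec_minus inner_minus_left inner_sum_right
        by (simp add: inner_axis of_int_vec_def mult.commute sum_negf)
      then show ?thesis
        unfolding character_def by (simp only: of_real_minus mult_minus_right mult_minus_left)
    qed
    then show ?thesis
      unfolding box_avg_def F_def coordinate_map_def by simp
  qed
  finally show ?thesis .
qed

theorem corollary3p3:
  fixes d :: nat
    and A :: "(rat^'n) set"
    and k :: "int^'n"
    and f :: "(real^'n \<Rightarrow> complex) \<Rightarrow> complex"
    and h :: "real^'n \<Rightarrow> complex"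
    and s :: real
  assumes "CARD('n) \<ge> 2"
    and "1 \<le> d" and "d \<le> CARD('n) - 1"
    and "A \<in> Gr d"
    and "f \<in> periodic_distributions"
    and "h \<in> torus_continuous"
    and "s \<ge> 0"
    and "f = one_minus_laplacian_pow s (distr_of h)"
    and "perp k A"
  shows "fourier_coeff f k
           = of_real (japanese_bracket k powr (2 * s)) * fourier_coeff (distr_of (radon_Gr d A h)) k \<and>
         of_real (japanese_bracket k powr (2 * s)) * fourier_coeff (distr_of (radon_Gr d A h)) k
           = fourier_coeff (radon_distr_Gr d A f) k \<and>
         (\<forall>v I. coordinate_frame d A v I \<longrightarrow>
           fourier_coeff (distr_of (radon_Gr d A h)) k
             = cube_integral I (\<lambda>T. radon_Gr d A h (coordinate_map d v I T (\<lambda>_. 0)) *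
                 exp (- 2 * of_real pi * \<i> * of_real (\<Sum>i\<in>I. of_int (k $ i) * T i))))"
proof -
  \<comment> \<open>The very choice made in \<open>radon_Gr\<close> and
    \<open>radon_distr_Gr\<close>, so both unfold to the same basis.\<close>
  define v where "v = (SOME v. integer_basis d A v)"
  have v: "integer_basis d A v"
    unfolding v_def using integer_basis_exists[OF assms(4)] by (rule someI_ex)
  have radon: "radon_Gr d A h = radon d v h"
    and radon_distr: "radon_distr_Gr d A f = radon_distr d v f"
    by (simp_all add: radon_Gr_def radon_distr_Gr_def v_def)
  have 1: "fourier_coeff f k
      = of_real (japanese_bracket k powr (2 * s)) * fourier_coeff (distr_of (radon_Gr d A h)) k"
    unfolding assms(8) one_minus_laplacian_pow_def fourier_coeff_multiplier radon
      fourier_coeff_radon[OF v assms(9,6)] ..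
  have 2: "fourier_coeff (radon_distr_Gr d A f) k = fourier_coeff f k"
    unfolding radon_distr fourier_coeff_def radon_distr_def
      restrict_apply'[OF character_test_fun] radon_character[OF v assms(9)] ..
  show ?thesis
    using 1 2 fourier_coeff_radon_frame[OF v assms(9,6)] unfolding radon
    by (intro conjI allI impI) (assumption | simp only:)+
qed

end
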